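(* There exists a metric Sierpiński carpet, i.e., a metric space homeomorphic to the standard Sierpiński carpet, that is quasisymmetrically co-Hopfian.
   Context: The standard Sierpiński carpet $S_3$ is the planar set obtained from the closed unit square by subdividing it into $9$ equal subsquares, removing the open middle one, and repeating this on the remaining subsquares indefinitely. A homeomorphism $f$ between metric spaces $(X,d_X)$ and $(Y,d_Y)$ is quasisymmetric if there is a homeomorphism $\eta\colon[0,\infty)\to[0,\infty)$ such that $$\frac{d_Y(f(p),f(q))}{d_Y(f(p),f(q'))}\le\eta\bigg(\frac{d_X(p,q)}{d_X(p,q')}\bigg)$$ for all triples of distinct points $p,q,q'\in X$. A quasisymmetric embedding of $(X,d_X)$ into $(Y,d_Y)$ is a one-to-one continuous map $f\colon X\to Y$ that is quasisymmetric as a map from $(X,d_X)$ to $(f(X),d_Y)$. A metric space $X$ is quasisymmetrically co-Hopfian if every quasisymmetric embedding of $X$ into itself is onto. *)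

theory Defs
  imports "HOL-Analysis.Analysis"
begin

text \<open>Lower left corners of the closed squares of side \<open>1/3^n\<close> that remain after \<open>n\<close> steps
  of the construction of the standard carpet.\<close>

fun carpet_corners :: "nat \<Rightarrow> (real \<times> real) set" where
  "carpet_corners 0 = {(0, 0)}"
| "carpet_corners (Suc n) =
     {(x + real i / 3 ^ Suc n, y + real j / 3 ^ Suc n) | x y i j.
        (x, y) \<in> carpet_corners n \<and> i < 3 \<and> j < 3 \<and> (i, j) \<noteq> (1, 1)}"

definition open_middle_square :: "nat \<Rightarrow> real \<times> real \<Rightarrow> (real \<times> real) set" where
  "open_middle_square n c =
     {fst c + 1 / 3 ^ Suc n <..< fst c + 2 / 3 ^ Suc n} \<times>
     {snd c + 1 / 3 ^ Suc n <..< snd c + 2 / 3 ^ Suc n}"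

fun carpet_stage :: "nat \<Rightarrow> (real \<times> real) set" where
  "carpet_stage 0 = {0..1} \<times> {0..1}"
| "carpet_stage (Suc n) = carpet_stage n - (\<Union>c\<in>carpet_corners n. open_middle_square n c)"

definition standard_carpet :: "(real \<times> real) set" where
  "standard_carpet = (\<Inter>n. carpet_stage n)"

definition metric_sierpinski_carpet :: "'a metric \<Rightarrow> bool" where
  "metric_sierpinski_carpet X \<longleftrightarrow>
     mtopology_of X homeomorphic_space top_of_set standard_carpet"

definition quasisymmetric_map :: "'a metric \<Rightarrow> 'b metric \<Rightarrow> ('a \<Rightarrow> 'b) \<Rightarrow> bool" where
  "quasisymmetric_map X Y f \<longleftrightarrow>
     homeomorphic_map (mtopology_of X) (mtopology_of Y) f \<and>
     (\<exists>\<eta> \<eta>' :: real \<Rightarrow> real. homeomorphism {0..} {0..} \<eta> \<eta>' \<and>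
        (\<forall>p\<in>mspace X. \<forall>q\<in>mspace X. \<forall>q'\<in>mspace X.
           p \<noteq> q \<and> p \<noteq> q' \<and> q \<noteq> q' \<longrightarrow>
           mdist Y (f p) (f q) / mdist Y (f p) (f q') \<le> \<eta> (mdist X p q / mdist X p q')))"

definition quasisymmetric_embedding :: "'a metric \<Rightarrow> 'b metric \<Rightarrow> ('a \<Rightarrow> 'b) \<Rightarrow> bool" where
  "quasisymmetric_embedding X Y f \<longleftrightarrow>
     inj_on f (mspace X) \<and>
     continuous_map (mtopology_of X) (mtopology_of Y) f \<and>
     quasisymmetric_map X (submetric Y (f ` mspace X)) f"

definition quasisymmetrically_co_Hopfian :: "'a metric \<Rightarrow> bool" where
  "quasisymmetrically_co_Hopfian X \<longleftrightarrow>
     (\<forall>f. quasisymmetric_embedding X X f \<longrightarrow> f ` mspace X = mspace X)"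

end

theory Submission
  imports Defs "HOL-Library.Nat_Bijection"
begin

text \<open>
  The carpet \<open>S\<close> is given a compatible metric \<open>d\<close> for which every quasisymmetric embedding into
  itself is the identity. Choose a dense sequence of points \<open>p k\<close> and rapidly decreasing scales
  \<open>r n\<close>, each assigned to one \<open>k\<close> in such a way that every \<open>k\<close> owns infinitely many scales. Let \<open>d\<close> be
  the supremum of the Euclidean metric and of pseudometrics of diameter \<open>r n\<close>, the \<open>n\<close>-th of which
  lives only in a tiny neighbourhood of the owner \<open>p k\<close> and creates there \<open>N n\<close> points that have
  distance \<open>r n\<close> from \<open>p k\<close> and are \<open>r n\<close>-separated.

  A quasisymmetric map \<open>f\<close> satisfies a lower Hoelder estimate at \<open>p k\<close>, obtained by iterating the
  distortion inequality along a connected set through \<open>p k\<close>. Hence for large \<open>n\<close> it carries these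
  points to \<open>N n\<close> points near \<open>f (p k)\<close> that are \<open>(r n)^n\<close>-separated. If \<open>f (p k) \<noteq> p k\<close>, then near
  \<open>f (p k)\<close> the \<open>n\<close>-th pseudometric vanishes, the later ones are smaller than \<open>(r n)^n\<close>, and the earlier
  ones are Lipschitz with a constant fixed before \<open>N n\<close>; so choosing \<open>N n\<close> larger than the cardinality
  that compactness of \<open>S\<close> allows gives a contradiction. Therefore \<open>f\<close> fixes every \<open>p k\<close>.
\<close>

section \<open>Real suprema, intermediate values and separated sets\<close>

lemma SUP_real_le_iff:
  fixes g :: "nat \<Rightarrow> real"
  assumes "\<And>n. g n \<le> B"
  shows "(SUP n. g n) \<le> c \<longleftrightarrow> (\<forall>n. g n \<le> c)"
proof -
  have "bdd_above (range g)"
    using assms by (auto intro!: bdd_aboveI2)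
  then show ?thesis
    by (simp add: cSUP_le_iff)
qed

lemma connected_real_function_attains:
  fixes f :: "'a::topological_space \<Rightarrow> real"
  assumes "connected E" "continuous_on E f" "a \<in> E" "b \<in> E" "f a \<le> v" "v \<le> f b"
  obtains x where "x \<in> E" "f x = v"
proof -
  have "connected (f ` E)"
    using assms connected_continuous_image by blast
  then have "v \<in> f ` E"
    using assms unfolding connected_iff_interval by blast
  then show ?thesis
    using that by blast
qed

text \<open>Pigeonhole: \<open>S\<close> is covered by finitely many balls of radius
  \<open>\<delta>/2\<close>, and each of them contains at most one point of a
  \<open>\<delta>\<close>-separated set.\<close>

lemma compact_separated_card_bound:
  fixes S :: "'a::metric_space set"
  assumes "compact S" "0 < \<delta>"
  shows "\<exists>M. \<forall>T\<subseteq>S. finite T \<longrightarrow> (\<forall>x\<in>T. \<forall>y\<in>T. x \<noteq> y \<longrightarrow> \<delta> \<le> dist x y) \<longrightarrow> card T \<le> M"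
proof -
  obtain K where K: "finite K" "S \<subseteq> (\<Union>x\<in>K. ball x (\<delta>/2))"
    using compact_imp_seq_compact[OF assms(1)] seq_compact_imp_totally_bounded assms(2)
    by (metis half_gt_zero)
  have "card T \<le> card K" if T: "T \<subseteq> S" "\<forall>x\<in>T. \<forall>y\<in>T. x \<noteq> y \<longrightarrow> \<delta> \<le> dist x y" for T
  proof -
    have "\<forall>x\<in>T. \<exists>k\<in>K. dist k x < \<delta>/2"
      using K T by fastforce
    then obtain g where g: "\<And>x. x \<in> T \<Longrightarrow> g x \<in> K \<and> dist (g x) x < \<delta>/2"
      by metis
    have "inj_on g T"
    proof (rule inj_onI, rule ccontr)
      fix x y assume xy: "x \<in> T" "y \<in> T" "g x = g y" "x \<noteq> y"
      have "dist x y < \<delta>"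
        using g[OF xy(1)] g[OF xy(2)] xy(3) dist_triangle_half_r by metis
      then show False
        using T xy by force
    qed
    then show ?thesis
      using g K(1) by (intro card_inj_on_le) auto
  qed
  then show ?thesis
    by blast
qed

section \<open>The rapidly decreasing scales\<close>

fun scale_exp :: "nat \<Rightarrow> nat" where
  "scale_exp 0 = 0"
| "scale_exp (Suc n) = Suc (Suc n * scale_exp n)"

text \<open>In terms of scales this is \<open>scale (Suc n) < scale n ^ n\<close>: no pseudometric
  of index above \<open>n\<close> can separate points by \<open>scale n ^ n\<close>.\<close>

lemma scale_exp_Suc_gt: "n * scale_exp n < scale_exp (Suc n)"
  by simp

lemma strict_mono_scale_exp: "strict_mono scale_exp"
  by (rule strict_monoI_Suc) simp

lemma le_scale_exp: "n \<le> scale_exp n"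
  using strict_mono_scale_exp by (rule strict_mono_imp_increasing)

abbreviation scale :: "nat \<Rightarrow> real" where
  "scale n \<equiv> (1/2) ^ scale_exp n"

lemma scale_antimono: "m \<le> n \<Longrightarrow> scale n \<le> scale m"
  using strict_mono_scale_exp by (intro power_decreasing) (auto simp: strict_mono_less_eq)

lemma scale_tendsto_0: "scale \<longlonglongrightarrow> 0"
proof (rule Lim_null_comparison)
  show "\<forall>\<^sub>F n in sequentially. norm (scale n) \<le> (1/2)^n"
    using le_scale_exp by (intro always_eventually allI) (simp add: power_decreasing)
  show "(\<lambda>n. (1/2::real)^n) \<longlonglongrightarrow> 0"
    by (rule LIMSEQ_power_zero) simp
qed

lemma scale_eventually_small: "0 < \<tau> \<Longrightarrow> \<exists>n0. \<forall>n\<ge>n0. scale n < \<tau>"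
  using order_tendstoD(2)[OF scale_tendsto_0, of \<tau>] by (simp add: eventually_sequentially)

section \<open>The metric \<open>bdist\<close> and its topology\<close>

locale branching_metric =
  fixes S :: "'a::metric_space set"
    and p :: "nat \<Rightarrow> 'a"
    and M :: "real \<Rightarrow> nat"
  assumes p_in: "p k \<in> S"
    and p_dense: "S \<subseteq> closure (range p)"
    and continuum_at_p: "\<exists>E z. connected E \<and> E \<subseteq> S \<and> p k \<in> E \<and> z \<in> E \<and> z \<noteq> p k"
    and separated_card_le: "\<lbrakk>0 < \<delta>; T \<subseteq> S; finite T;
          \<And>x y. \<lbrakk>x \<in> T; y \<in> T; x \<noteq> y\<rbrakk> \<Longrightarrow> \<delta> \<le> dist x y\<rbrakk> \<Longrightarrow> card T \<le> M \<delta>"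
begin

text \<open>\<open>lip n\<close> will be a common Lipschitz constant of the pseudometrics
  \<open>branch m\<close> with \<open>m < n\<close>. It is known before the new factor is chosen.
  That factor, named \<open>branches n\<close> below, exceeds the bound \<open>M\<close> on the size
  of \<open>scale n ^ n / lip n\<close>-separated finite subsets of \<open>S\<close>.\<close>

primrec lip :: "nat \<Rightarrow> real" where
  "lip 0 = 1"
| "lip (Suc n) = lip n * Suc (M (scale n ^ n / lip n))"

definition branches :: "nat \<Rightarrow> nat" where
  "branches n = Suc (M (scale n ^ n / lip n))"

text \<open>Decoding pairs makes every fibre infinite: \<open>k\<close> owns all
  \<open>prod_encode (k, m)\<close>.\<close>

definition owner :: "nat \<Rightarrow> nat" where
  "owner n = fst (prod_decode n)"

text \<open>The cut-off makes this function constant outside the ball of radius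
  \<open>scale n / lip n\<close> about the owner, so that \<open>branch n\<close> vanishes
  there.\<close>

definition trunc_dist :: "nat \<Rightarrow> 'a \<Rightarrow> real" where
  "trunc_dist n x = min (scale n / lip n) (dist x (p (owner n)))"

text \<open>The values of \<open>trunc_dist n\<close> lie in an interval of length
  \<open>scale n / lip n\<close>. The factor \<open>lip (Suc n)\<close> stretches it to length
  \<open>branches n * scale n\<close>, which leaves room for the owner and \<open>branches n\<close>
  further points with gaps \<open>scale n\<close>.\<close>

definition branch :: "nat \<Rightarrow> 'a \<Rightarrow> 'a \<Rightarrow> real" where
  "branch n x y = min (scale n) (lip (Suc n) * \<bar>trunc_dist n x - trunc_dist n y\<bar>)"

definition bdist :: "'a \<Rightarrow> 'a \<Rightarrow> real" where
  "bdist x y = (SUP n. max (dist x y) (branch n x y))"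

lemma lip_Suc: "lip (Suc n) = lip n * branches n"
  by (simp add: branches_def)

declare lip.simps(2) [simp del]

lemma branches_pos: "0 < branches n"
  by (simp add: branches_def)

lemma lip_ge_1: "1 \<le> lip n"
proof (induction n)
  case (Suc n)
  have "1 * 1 \<le> lip n * real (branches n)"
    using Suc branches_pos[of n] by (intro mult_mono) auto
  then show ?case
    by (simp add: lip_Suc)
qed simp

lemma lip_pos: "0 < lip n"
  using lip_ge_1[of n] by linarith

lemma lip_mono: "m \<le> n \<Longrightarrow> lip m \<le> lip n"
proof (rule lift_Suc_mono_le[of lip])
  fix n
  have "lip n * 1 \<le> lip n * real (branches n)"
    using lip_pos[of n] branches_pos[of n] by (intro mult_left_mono) auto
  then show "lip n \<le> lip (Suc n)"
    by (simp add: lip_Suc)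
qed

lemma owner_infinitely_often: "\<exists>n\<ge>n0. owner n = k"
  by (rule exI[of _ "prod_encode (k, n0)"]) (simp add: owner_def le_prod_encode_2)

lemma branch_nonneg: "0 \<le> branch n x y"
  using lip_pos[of "Suc n"] by (simp add: branch_def)

lemma branch_le_scale: "branch n x y \<le> scale n"
  by (simp add: branch_def)

lemma branch_le_lip: "branch n x y \<le> lip (Suc n) * dist x y"
proof -
  have "\<bar>trunc_dist n x - trunc_dist n y\<bar> \<le> \<bar>dist x (p (owner n)) - dist y (p (owner n))\<bar>"
    by (auto simp: trunc_dist_def)
  also have "\<dots> \<le> dist x y"
    using dist_triangle[of x "p (owner n)" y] dist_triangle3[of y "p (owner n)" x]
    by (auto simp: dist_commute abs_le_iff)
  finally show ?thesis
    using lip_pos[of "Suc n"] unfolding branch_def by (auto intro!: min.coboundedI2)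
qed

lemma branch_sym: "branch n x y = branch n y x"
  by (simp add: branch_def abs_minus_commute)

lemma branch_refl: "branch n x x = 0"
  by (simp add: branch_def)

lemma branch_triangle: "branch n x z \<le> branch n x y + branch n y z"
proof -
  have "\<bar>trunc_dist n x - trunc_dist n z\<bar>
      \<le> \<bar>trunc_dist n x - trunc_dist n y\<bar> + \<bar>trunc_dist n y - trunc_dist n z\<bar>"
    by linarith
  then have "lip (Suc n) * \<bar>trunc_dist n x - trunc_dist n z\<bar>
      \<le> lip (Suc n) * \<bar>trunc_dist n x - trunc_dist n y\<bar> + lip (Suc n) * \<bar>trunc_dist n y - trunc_dist n z\<bar>"
    using lip_pos[of "Suc n"] by (metis distrib_left mult_left_mono less_imp_le)
  moreover have "0 \<le> lip (Suc n) * \<bar>trunc_dist n x - trunc_dist n y\<bar>"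
      "0 \<le> lip (Suc n) * \<bar>trunc_dist n y - trunc_dist n z\<bar>" "0 \<le> scale n"
    using lip_pos[of "Suc n"] by simp_all
  ultimately show ?thesis
    unfolding branch_def by linarith
qed

lemma bdist_le_iff: "bdist x y \<le> c \<longleftrightarrow> dist x y \<le> c \<and> (\<forall>n. branch n x y \<le> c)"
proof -
  \<comment> \<open>All scales are at most 1, so the supremum in \<open>bdist\<close> is over a
    bounded family.\<close>
  have "max (dist x y) (branch n x y) \<le> max (dist x y) 1" for n
    using branch_le_scale[of n x y] power_le_one[of "1/2::real" "scale_exp n"] by auto
  from SUP_real_le_iff[OF this] show ?thesis
    unfolding bdist_def by auto
qed

lemma dist_le_bdist: "dist x y \<le> bdist x y"
  and branch_le_bdist: "branch n x y \<le> bdist x y"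
  using bdist_le_iff[of x y "bdist x y"] by auto

lemma bdist_sym: "bdist x y = bdist y x"
  by (simp add: bdist_def branch_sym dist_commute)

lemma bdist_triangle: "bdist x z \<le> bdist x y + bdist y z"
  unfolding bdist_le_iff
proof (intro conjI allI)
  show "dist x z \<le> bdist x y + bdist y z"
    using dist_triangle[of x z y] dist_le_bdist[of x y] dist_le_bdist[of y z] by linarith
  show "branch n x z \<le> bdist x y + bdist y z" for n
    using branch_triangle[of n x z y] branch_le_bdist[of n x y] branch_le_bdist[of n y z]
    by linarith
qed

lemma bdist_nonneg: "0 \<le> bdist x y"
  using dist_le_bdist[of x y] zero_le_dist[of x y] by linarith

lemma bdist_eq_0_iff: "bdist x y = 0 \<longleftrightarrow> x = y"
proof
  assume "bdist x y = 0"
  then show "x = y"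
    using dist_le_bdist[of x y] by simp
next
  assume "x = y"
  then have "bdist x y \<le> 0"
    by (simp add: bdist_le_iff branch_refl)
  then show "bdist x y = 0"
    using bdist_nonneg[of x y] by simp
qed

lemma bdist_pos_iff: "0 < bdist x y \<longleftrightarrow> x \<noteq> y"
  using bdist_nonneg[of x y] bdist_eq_0_iff[of x y] by linarith

text \<open>Split the supremum at \<open>n\<close>: the pseudometrics below \<open>n\<close> are
  Lipschitz with constant \<open>lip n\<close>, the others are at most
  \<open>scale n\<close>.\<close>

lemma bdist_le_max: "bdist x y \<le> max (lip n * dist x y) (scale n)"
  unfolding bdist_le_iff
proof (intro conjI allI)
  have "1 * dist x y \<le> lip n * dist x y"
    using lip_ge_1 by (intro mult_right_mono) auto
  then show "dist x y \<le> max (lip n * dist x y) (scale n)"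
    by simp
next
  fix m
  show "branch m x y \<le> max (lip n * dist x y) (scale n)"
  proof (cases "m < n")
    case True
    then have "lip (Suc m) * dist x y \<le> lip n * dist x y"
      by (intro mult_right_mono lip_mono) auto
    then show ?thesis
      using branch_le_lip[of m x y] by linarith
  next
    case False
    then show ?thesis
      using branch_le_scale[of m x y] scale_antimono[of n m] by linarith
  qed
qed

lemma bdist_small:
  assumes "0 < \<tau>"
  shows "\<exists>\<sigma>>0. \<forall>x y. dist x y < \<sigma> \<longrightarrow> bdist x y < \<tau>"
proof -
  obtain n where n: "scale n < \<tau>"
    using scale_eventually_small[OF assms] by auto
  have "bdist x y < \<tau>" if "dist x y < \<tau> / lip n" for x y
  proof -
    have "lip n * dist x y < \<tau>"
      using that lip_pos[of n] by (simp add: field_simps)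
    then show ?thesis
      using bdist_le_max[of x y n] n by linarith
  qed
  then show ?thesis
    using assms lip_pos[of n] by (intro exI[of _ "\<tau> / lip n"]) auto
qed

lemma continuous_on_bdist: "continuous_on E (bdist a)"
proof -
  have "\<exists>\<sigma>>0. \<forall>y\<in>E. dist y x < \<sigma> \<longrightarrow> dist (bdist a y) (bdist a x) < \<tau>"
    if \<tau>: "0 < \<tau>" for x \<tau>
  proof -
    obtain \<sigma> where \<sigma>: "\<sigma> > 0" "\<And>x y. dist x y < \<sigma> \<Longrightarrow> bdist x y < \<tau>"
      using bdist_small[OF \<tau>] by blast
    have "dist (bdist a y) (bdist a x) < \<tau>" if "dist y x < \<sigma>" for y
      using \<sigma>(2)[OF that] bdist_triangle[of a y x] bdist_triangle[of a x y] bdist_sym[of x y]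
      by (simp add: dist_real_def)
    then show ?thesis
      using \<sigma>(1) by blast
  qed
  then show ?thesis
    by (simp add: continuous_on_iff)
qed

lemma Metric_space_bdist: "Metric_space S bdist"
  by unfold_locales (rule bdist_nonneg bdist_sym bdist_eq_0_iff bdist_triangle)+

definition bmetric :: "'a metric" where
  "bmetric = metric (S, bdist)"

lemma mspace_bmetric [simp]: "mspace bmetric = S"
  by (simp add: bmetric_def Metric_space.mspace_metric[OF Metric_space_bdist])

lemma mdist_bmetric [simp]: "mdist bmetric = bdist"
  by (simp add: bmetric_def Metric_space.mdist_metric[OF Metric_space_bdist])

text \<open>\<open>bdist_small\<close> puts a \<open>dist\<close>-ball inside every
  \<open>bdist\<close>-ball, and \<open>dist_le_bdist\<close> gives the reverse inclusion.\<close>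

lemma mtopology_bmetric: "mtopology_of bmetric = top_of_set S"
proof -
  interpret B: Metric_space S bdist
    by (rule Metric_space_bdist)
  have "openin B.mtopology U \<longleftrightarrow> openin (top_of_set S) U" for U
  proof
    assume U: "openin B.mtopology U"
    show "openin (top_of_set S) U"
      unfolding openin_euclidean_subtopology_iff
    proof (intro conjI ballI)
      show "U \<subseteq> S"
        using U by (simp add: B.openin_mtopology)
      fix x assume x: "x \<in> U"
      then obtain \<tau> where \<tau>: "\<tau> > 0" "B.mball x \<tau> \<subseteq> U"
        using U by (auto simp: B.openin_mtopology)
      obtain \<sigma> where \<sigma>: "\<sigma> > 0" "\<And>x y. dist x y < \<sigma> \<Longrightarrow> bdist x y < \<tau>"
        using bdist_small[OF \<tau>(1)] by blast
      have "y \<in> U" if "y \<in> S" "dist y x < \<sigma>" for y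
        using \<sigma>(2)[of x y] that \<tau>(2) x \<open>U \<subseteq> S\<close> by (auto simp: B.mball_def dist_commute)
      then show "\<exists>e>0. \<forall>x'\<in>S. dist x' x < e \<longrightarrow> x' \<in> U"
        using \<sigma>(1) by blast
    qed
  next
    assume U: "openin (top_of_set S) U"
    show "openin B.mtopology U"
      unfolding B.openin_mtopology
    proof (intro conjI allI impI)
      show "U \<subseteq> S"
        using U by (simp add: openin_imp_subset)
      fix x assume "x \<in> U"
      then obtain e where e: "e > 0" "\<forall>y\<in>S. dist y x < e \<longrightarrow> y \<in> U"
        using U by (auto simp: openin_euclidean_subtopology_iff)
      have "B.mball x e \<subseteq> U"
      proof
        fix y assume "y \<in> B.mball x e"
        then have "y \<in> S" "bdist x y < e"
          by auto
        then show "y \<in> U"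
          using e(2) dist_le_bdist[of x y] by (simp add: dist_commute)
      qed
      then show "\<exists>r>0. B.mball x r \<subseteq> U"
        using e(1) by blast
    qed
  qed
  then have "B.mtopology = top_of_set S"
    by (simp add: topology_eq)
  then show ?thesis
    by (simp add: mtopology_of_def)
qed

section \<open>Separated points close to an owner and far from it\<close>

lemma branch_points:
  assumes "owner n = k" "connected E" "p k \<in> E" "z \<in> E" "scale n / lip n \<le> dist z (p k)"
  obtains x where "\<And>i. i < branches n \<Longrightarrow> x i \<in> E"
    and "\<And>i. i < branches n \<Longrightarrow> bdist (p k) (x i) = scale n"
    and "\<And>i j. \<lbrakk>i < branches n; j < branches n; i \<noteq> j\<rbrakk> \<Longrightarrow> scale n \<le> bdist (x i) (x j)"
proof -
  define s where "s = scale n / lip n"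
  \<comment> \<open>Equally spaced distances to \<open>p k\<close>, attained on \<open>E\<close> by
    connectedness. Counting from \<open>Suc i\<close> reserves the value 0 for \<open>p k\<close>
    itself, which is then \<open>scale n\<close> away from every \<open>x i\<close> as well.\<close>
  let ?v = "\<lambda>i. s * real (Suc i) / branches n"
  have s: "0 < s"
    using lip_pos by (simp add: s_def)
  have ex: "\<exists>x\<in>E. dist x (p k) = ?v i" if "i < branches n" for i
  proof -
    have "s * real (Suc i) \<le> s * real (branches n)"
      using that s by (intro mult_left_mono) auto
    then have "?v i \<le> s"
      using branches_pos[of n] by (simp add: field_simps)
    then have "?v i \<le> dist z (p k)"
      using assms(5) by (simp add: s_def)
    moreover have "dist (p k) (p k) \<le> ?v i"
      using s by simp
    moreover have "continuous_on E (\<lambda>x. dist x (p k))"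
      by (intro continuous_intros)
    ultimately show ?thesis
      using connected_real_function_attains[OF assms(2) _ assms(3,4), of "\<lambda>x. dist x (p k)" "?v i"]
      by blast
  qed
  then obtain x where x: "\<And>i. i < branches n \<Longrightarrow> x i \<in> E \<and> dist (x i) (p k) = ?v i"
    by metis
  have trunc: "trunc_dist n (x i) = ?v i" if "i < branches n" for i
  proof -
    have "s * real (Suc i) \<le> s * real (branches n)"
      using that s by (intro mult_left_mono) auto
    then have "?v i \<le> s"
      using branches_pos[of n] by (simp add: field_simps)
    then show ?thesis
      using x[OF that] assms(1) by (simp add: trunc_dist_def s_def)
  qed
  have branch: "branch n y z = scale n"
    if "trunc_dist n y = s * real a / branches n" "trunc_dist n z = s * real b / branches n"
       "a \<noteq> b" for y z a b
  proof -
    have "1 \<le> \<bar>real a - real b\<bar>"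
      using that(3) by linarith
    moreover have "trunc_dist n y - trunc_dist n z = (s / branches n) * (real a - real b)"
      unfolding that(1,2) by (simp add: algebra_simps diff_divide_distrib)
    ultimately have "s / branches n * 1 \<le> \<bar>trunc_dist n y - trunc_dist n z\<bar>"
      using s by (simp only: abs_mult abs_divide) (intro mult_mono, auto)
    then have "lip (Suc n) * (s / branches n) \<le> lip (Suc n) * \<bar>trunc_dist n y - trunc_dist n z\<bar>"
      using lip_pos[of "Suc n"] by (intro mult_left_mono) auto
    moreover have "lip (Suc n) * (s / branches n) = scale n"
      using lip_pos[of n] branches_pos[of n] by (simp add: lip_Suc s_def)
    ultimately show ?thesis
      by (simp add: branch_def)
  qed
  have p0: "trunc_dist n (p k) = s * real 0 / branches n"
    using assms(1) s by (simp add: trunc_dist_def s_def)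
  show thesis
  proof (rule that[of x])
    show "x i \<in> E" if "i < branches n" for i
      using x that by blast
    show "scale n \<le> bdist (x i) (x j)" if "i < branches n" "j < branches n" "i \<noteq> j" for i j
      using branch[OF trunc[OF that(1)] trunc[OF that(2)]] that(3)
        branch_le_bdist[of n "x i" "x j"] by simp
    show "bdist (p k) (x i) = scale n" if "i < branches n" for i
    proof (rule antisym)
      have "?v i \<le> s"
        using trunc[OF that] by (simp add: trunc_dist_def s_def)
      then have "dist (p k) (x i) \<le> s"
        using x[OF that] by (simp add: dist_commute)
      then have "lip n * dist (p k) (x i) \<le> scale n"
        using lip_pos[of n] by (simp add: s_def field_simps)
      then show "bdist (p k) (x i) \<le> scale n"
        using bdist_le_max[of "p k" "x i" n] by linarith
      show "scale n \<le> bdist (p k) (x i)"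
        using branch[OF p0 trunc[OF that]] branch_le_bdist[of n "p k" "x i"] by simp
    qed
  qed
qed

text \<open>Compared with \<open>bdist_le_max\<close>, the term of index \<open>n\<close> drops out,
  because \<open>trunc_dist n\<close> takes the same value at both points.\<close>

lemma bdist_away_from_owner:
  assumes "scale n / lip n \<le> dist x (p (owner n))" "scale n / lip n \<le> dist y (p (owner n))"
  shows "bdist x y \<le> max (lip n * dist x y) (scale (Suc n))"
  unfolding bdist_le_iff
proof (intro conjI allI)
  have "1 * dist x y \<le> lip n * dist x y"
    using lip_ge_1 by (intro mult_right_mono) auto
  then show "dist x y \<le> max (lip n * dist x y) (scale (Suc n))"
    by simp
next
  fix m
  consider "m < n" | "m = n" | "Suc n \<le> m"
    by linarith
  then show "branch m x y \<le> max (lip n * dist x y) (scale (Suc n))"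
  proof cases
    case 1
    then have "lip (Suc m) * dist x y \<le> lip n * dist x y"
      by (intro mult_right_mono lip_mono) auto
    then show ?thesis
      using branch_le_lip[of m x y] by linarith
  next
    case 2
    have "branch n x y = 0"
      using assms by (simp add: branch_def trunc_dist_def)
    then show ?thesis
      using 2 by (simp add: max.coboundedI2)
  next
    case 3
    then show ?thesis
      using branch_le_scale[of m x y] scale_antimono[of "Suc n" m] by linarith
  qed
qed

text \<open>Since \<open>scale n ^ n\<close> exceeds \<open>scale (Suc n)\<close>, the separation
  must come from the Lipschitz term. It is thus a \<open>dist\<close>-separation by
  \<open>scale n ^ n / lip n\<close>, and \<open>branches n\<close> was chosen too large for
  that.\<close>

lemma few_separated_points_away_from_owner:
  assumes "T \<subseteq> S" "finite T"
    and "\<And>x. x \<in> T \<Longrightarrow> scale n / lip n \<le> dist x (p (owner n))"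
    and sep: "\<And>x y. \<lbrakk>x \<in> T; y \<in> T; x \<noteq> y\<rbrakk> \<Longrightarrow> scale n ^ n \<le> bdist x y"
  shows "card T < branches n"
proof -
  have "scale n ^ n / lip n \<le> dist x y" if "x \<in> T" "y \<in> T" "x \<noteq> y" for x y
  proof -
    have "scale (Suc n) < (1/2) ^ (n * scale_exp n)"
      by (rule power_strict_decreasing[OF scale_exp_Suc_gt]) auto
    also have "\<dots> = scale n ^ n"
      by (simp add: power_mult[symmetric] mult.commute)
    finally have "scale (Suc n) < scale n ^ n" .
    then have "scale n ^ n \<le> lip n * dist x y"
      using sep[OF that] bdist_away_from_owner[of n x y] assms(3) that by fastforce
    then show ?thesis
      using lip_pos[of n] by (simp add: field_simps)
  qed
  moreover have "0 < scale n ^ n / lip n"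
    using lip_pos by simp
  ultimately show ?thesis
    using separated_card_le[of "scale n ^ n / lip n" T] assms(1,2)
    by (simp add: branches_def less_Suc_eq_le)
qed

section \<open>Quasisymmetric embeddings fix every \<open>p k\<close>\<close>

text \<open>Each halving of the distance to \<open>p k\<close> shrinks the distance of the image to
  \<open>a\<close> by a factor of at most \<open>H\<close>, and a connected set through
  \<open>p k\<close> supplies points at all small dyadic distances to iterate this. As
  \<open>H ^ t\<close> is a power of \<open>(1/2)^t\<close>, the result is a lower Hoelder bound;
  later \<open>a\<close> is \<open>f (p k)\<close>.\<close>

lemma lower_hoelder_at_p:
  assumes ratio: "\<And>x y. \<lbrakk>x \<in> S; y \<in> S; x \<noteq> p k; y \<noteq> p k; bdist (p k) x = 2 * bdist (p k) y\<rbrakk>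
      \<Longrightarrow> bdist a (f x) \<le> H * bdist a (f y)"
    and inj: "\<And>x. \<lbrakk>x \<in> S; x \<noteq> p k\<rbrakk> \<Longrightarrow> f x \<noteq> a"
    and H: "1 \<le> H"
  obtains c t0 where "0 < c"
    "\<And>x t. \<lbrakk>x \<in> S; t0 < t; bdist (p k) x = (1/2)^t\<rbrakk> \<Longrightarrow> c \<le> H ^ t * bdist a (f x)"
proof -
  obtain E z where E: "connected E" "E \<subseteq> S" "p k \<in> E" "z \<in> E" "z \<noteq> p k"
    using continuum_at_p by blast
  obtain t0 where t0: "(1/2)^t0 < bdist (p k) z"
    using real_arch_pow_inv[of "bdist (p k) z" "1/2"] bdist_pos_iff E(5) by fastforce
  have "\<exists>q\<in>E. bdist (p k) q = (1/2)^t" if "t0 \<le> t" for t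
  proof -
    have "(1/2::real)^t \<le> (1/2)^t0"
      using that by (intro power_decreasing) auto
    then have "(1/2)^t \<le> bdist (p k) z"
      using t0 by linarith
    moreover have "bdist (p k) (p k) \<le> (1/2)^t"
      using bdist_eq_0_iff[of "p k" "p k"] by simp
    ultimately show ?thesis
      using connected_real_function_attains[OF E(1) continuous_on_bdist E(3,4)] by metis
  qed
  then obtain q where q: "\<And>t. t0 \<le> t \<Longrightarrow> q t \<in> E \<and> bdist (p k) (q t) = (1/2)^t"
    by metis
  have nz: "x \<noteq> p k" if "bdist (p k) x = (1/2)^t" for x t
    using that bdist_eq_0_iff[of "p k" x] by auto
  have chain: "bdist a (f (q t0)) \<le> H ^ d * bdist a (f (q (t0 + d)))" for d
  proof (induction d)
    case (Suc d)
    have "bdist a (f (q (t0 + d))) \<le> H * bdist a (f (q (t0 + Suc d)))"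
      using q[of "t0 + d"] q[of "t0 + Suc d"] nz[of "q (t0 + d)" "t0 + d"]
        nz[of "q (t0 + Suc d)" "t0 + Suc d"] E(2)
      by (intro ratio) auto
    then have "H ^ d * bdist a (f (q (t0 + d))) \<le> H ^ d * (H * bdist a (f (q (t0 + Suc d))))"
      using H by (intro mult_left_mono) auto
    then show ?case
      using Suc by (simp add: mult.assoc mult.left_commute)
  qed simp
  show thesis
  proof (rule that[of "bdist a (f (q t0))" t0])
    show "0 < bdist a (f (q t0))"
      using inj[of "q t0"] q[of t0] nz E(2) by (auto simp: bdist_pos_iff)
    fix x t assume x: "x \<in> S" "t0 < t" "bdist (p k) x = (1/2)^t"
    \<comment> \<open>The last link compares \<open>x\<close> with the chain point
      \<open>q (t0 + d)\<close> at twice its distance from \<open>p k\<close>; hence the strict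
      inequality \<open>t0 < t\<close>.\<close>
    define d where "d = t - Suc t0"
    have t: "t = Suc (t0 + d)"
      using x(2) by (simp add: d_def)
    have "bdist a (f (q (t0 + d))) \<le> H * bdist a (f x)"
      using q[of "t0 + d"] nz[of "q (t0 + d)" "t0 + d"] nz[OF x(3)] E(2) x
      by (intro ratio) (auto simp: t)
    then have "H ^ d * bdist a (f (q (t0 + d))) \<le> H ^ d * (H * bdist a (f x))"
      using H by (intro mult_left_mono) auto
    also have "\<dots> = H ^ Suc d * bdist a (f x)"
      by simp
    also have "\<dots> \<le> H ^ t * bdist a (f x)"
      using H bdist_nonneg by (intro mult_right_mono power_increasing) (auto simp: t)
    finally show "bdist a (f (q t0)) \<le> H ^ t * bdist a (f x)"
      using chain[of d] by linarith
  qed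
qed

lemma quasisymmetric_embedding_fixes_p:
  assumes f: "quasisymmetric_embedding bmetric bmetric f"
  shows "f (p k) = p k"
proof (rule ccontr)
  assume moved: "f (p k) \<noteq> p k"
  have inj: "inj_on f S"
    and cont: "continuous_on S f" and fS: "f ` S \<subseteq> S"
    using f by (auto simp: quasisymmetric_embedding_def mtopology_bmetric)
  obtain \<eta> \<eta>' :: "real \<Rightarrow> real" where hom: "homeomorphism {0..} {0..} \<eta> \<eta>'"
    and qs0: "\<And>x y z. \<lbrakk>x \<in> S; y \<in> S; z \<in> S; x \<noteq> y; x \<noteq> z; y \<noteq> z\<rbrakk> \<Longrightarrow>
        bdist (f x) (f y) / bdist (f x) (f z) \<le> \<eta> (bdist x y / bdist x z)"
    using f by (auto simp: quasisymmetric_embedding_def quasisymmetric_map_def)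
  have qs: "bdist (f x) (f y) \<le> \<eta> (bdist x y / bdist x z) * bdist (f x) (f z)"
    if "x \<in> S" "y \<in> S" "z \<in> S" "x \<noteq> y" "x \<noteq> z" "y \<noteq> z" for x y z
  proof -
    have "f x \<noteq> f z"
      using inj that by (auto simp: inj_on_def)
    then show ?thesis
      using qs0[OF that] by (simp add: bdist_pos_iff pos_divide_le_eq)
  qed
  \<comment> \<open>The ratios met below have numerator \<open>scale n\<close> and a denominator
    between \<open>scale n\<close> and \<open>2 * scale n\<close>.\<close>
  have "continuous_on {1/2..1} \<eta>"
    using hom by (auto simp: homeomorphism_def intro: continuous_on_subset)
  then have "bdd_above (\<eta> ` {1/2..1})"
    by (intro bounded_imp_bdd_above compact_imp_bounded compact_continuous_image) auto
  then obtain K0 where K0: "\<And>v. v \<in> {1/2..1} \<Longrightarrow> \<eta> v \<le> K0"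
    by (metis bdd_above_def imageI)
  define K where "K = max 1 K0"
  define H where "H = max 1 (\<eta> 2)"
  obtain c t0 where c: "0 < c"
    "\<And>x t. \<lbrakk>x \<in> S; t0 < t; bdist (p k) x = (1/2)^t\<rbrakk> \<Longrightarrow> c \<le> H ^ t * bdist (f (p k)) (f x)"
  proof (rule lower_hoelder_at_p[of k "f (p k)" f H])
    fix x y assume xy: "x \<in> S" "y \<in> S" "x \<noteq> p k" "y \<noteq> p k" "bdist (p k) x = 2 * bdist (p k) y"
    have y: "0 < bdist (p k) y"
      using xy by (simp add: bdist_pos_iff)
    then have "x \<noteq> y"
      using xy(5) by auto
    then have "bdist (f (p k)) (f x) \<le> \<eta> 2 * bdist (f (p k)) (f y)"
      using qs[of "p k" x y] xy y p_in by auto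
    also have "\<dots> \<le> H * bdist (f (p k)) (f y)"
      using bdist_nonneg by (intro mult_right_mono) (auto simp: H_def)
    finally show "bdist (f (p k)) (f x) \<le> H * bdist (f (p k)) (f y)" .
  next
    show "f x \<noteq> f (p k)" if "x \<in> S" "x \<noteq> p k" for x
      using inj that p_in by (auto simp: inj_on_def)
  qed (auto simp: H_def)
  obtain E z where E: "connected E" "E \<subseteq> S" "p k \<in> E" "z \<in> E" "z \<noteq> p k"
    using continuum_at_p by blast
  \<comment> \<open>With half the displacement, points within \<open>\<tau>\<close> of
    \<open>f (p k)\<close> stay at least \<open>\<tau>\<close> away from \<open>p k\<close>.\<close>
  define \<tau> where "\<tau> = dist (f (p k)) (p k) / 2"
  have \<tau>: "0 < \<tau>"
    using moved by (simp add: \<tau>_def)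
  obtain \<sigma> where \<sigma>: "\<sigma> > 0" "\<And>x. \<lbrakk>x \<in> S; dist x (p k) < \<sigma>\<rbrakk> \<Longrightarrow> dist (f x) (f (p k)) < \<tau>"
    using cont p_in[of k] \<tau> unfolding continuous_on_iff by metis
  \<comment> \<open>Three thresholds: \<open>\<tau>\<close> keeps the images out of the owner's
    ball, \<open>\<sigma>\<close> makes continuity applicable to the branch points, and
    \<open>dist z (p k)\<close> lets these points be found on \<open>E\<close>.\<close>
  obtain n0 where n0: "\<And>n. n \<ge> n0 \<Longrightarrow> scale n < Min {\<tau>, \<sigma>, dist z (p k)}"
    using scale_eventually_small[of "Min {\<tau>, \<sigma>, dist z (p k)}"] \<tau> \<sigma>(1) E(5) by auto
  obtain n1 where n1: "2 * H < 2 ^ n1"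
    using real_arch_pow[of 2 "2 * H"] by auto
  obtain n2 where n2: "K / c < 2 ^ n2"
    using real_arch_pow[of 2 "K / c"] by auto
  obtain n where n: "n \<ge> Max {n0, n1, n2, Suc t0}" "owner n = k"
    using owner_infinitely_often by blast
  have small: "scale n < \<tau>" "scale n < \<sigma>" "scale n < dist z (p k)"
    using n0[of n] n(1) by auto
  have step: "scale n / lip n \<le> scale n"
    using lip_ge_1[of n] lip_pos[of n] by (simp add: field_simps)
  obtain x where x: "\<And>i. i < branches n \<Longrightarrow> x i \<in> E"
    "\<And>i. i < branches n \<Longrightarrow> bdist (p k) (x i) = scale n"
    "\<And>i j. \<lbrakk>i < branches n; j < branches n; i \<noteq> j\<rbrakk> \<Longrightarrow> scale n \<le> bdist (x i) (x j)"
    using branch_points[OF n(2) E(1,3,4)] step small(3) by auto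
  have xS: "x i \<in> S" if "i < branches n" for i
    using x(1)[OF that] E(2) by blast
  \<comment> \<open>Rearranged, \<open>scale n ^ n\<close> is at most
    \<open>c / (H ^ scale_exp n * K)\<close>. The exponent \<open>n\<close> beats the fixed Hoelder
    exponent through \<open>n1\<close>, the constants through \<open>n2\<close>.\<close>
  have big: "K \<le> c * (2 ^ n / H) ^ scale_exp n"
  proof -
    have "(2::real) ^ n1 \<le> 2 ^ n"
      using n(1) by (intro power_increasing) auto
    then have "2 * H \<le> 2 ^ n"
      using n1 by linarith
    moreover have "0 < H"
      by (simp add: H_def)
    ultimately have "2 \<le> 2 ^ n / H"
      by (simp add: pos_le_divide_eq)
    then have "2 ^ scale_exp n \<le> (2 ^ n / H) ^ scale_exp n"
      by (intro power_mono) auto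
    moreover have "(2::real) ^ n2 \<le> 2 ^ scale_exp n"
      using n(1) le_scale_exp[of n] by (intro power_increasing) auto
    ultimately have "K / c \<le> (2 ^ n / H) ^ scale_exp n"
      using n2 by linarith
    then show ?thesis
      using c(1) by (simp add: field_simps)
  qed
  \<comment> \<open>Quasisymmetry centred at \<open>x i\<close> bounds the distance from
    \<open>f (x i)\<close> to \<open>f (p k)\<close> by \<open>K\<close> times that to
    \<open>f (x j)\<close>; the Hoelder estimate bounds the former from below.\<close>
  have sep: "scale n ^ n \<le> bdist (f (x i)) (f (x j))"
    if ij: "i < branches n" "j < branches n" "i \<noteq> j" for i j
  proof -
    have xij: "bdist (x i) (p k) = scale n" "scale n \<le> bdist (x i) (x j)"
      using x(2)[OF ij(1)] x(3)[OF ij] by (auto simp: bdist_sym)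
    have pos: "0 < scale n"
      by simp
    have ne: "x i \<noteq> p k" "x j \<noteq> p k" "x i \<noteq> x j"
      using x(2)[OF ij(1)] x(2)[OF ij(2)] x(3)[OF ij]
        pos bdist_pos_iff
      by (metis, metis, fastforce simp: bdist_eq_0_iff[THEN iffD2])
    have "bdist (x i) (x j) \<le> 2 * scale n"
      using bdist_triangle[of "x i" "x j" "p k"] xij(1) x(2)[OF ij(2)] by simp
    moreover have "0 < bdist (x i) (x j)"
      using xij(2) pos by linarith
    ultimately have "bdist (x i) (p k) / bdist (x i) (x j) \<in> {1/2..1}"
      using xij by (simp add: pos_divide_le_eq pos_le_divide_eq)
    then have "\<eta> (bdist (x i) (p k) / bdist (x i) (x j)) \<le> K"
      using K0 by (auto simp: K_def intro: max.coboundedI2)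
    then have "\<eta> (bdist (x i) (p k) / bdist (x i) (x j)) * bdist (f (x i)) (f (x j))
        \<le> K * bdist (f (x i)) (f (x j))"
      using bdist_nonneg by (intro mult_right_mono)
    then have up: "bdist (f (x i)) (f (p k)) \<le> K * bdist (f (x i)) (f (x j))"
      using qs[of "x i" "p k" "x j"] ne xS[OF ij(1)] xS[OF ij(2)] p_in[of k] by auto
    have "t0 < scale_exp n"
      using n(1) le_scale_exp[of n] by auto
    then have "c \<le> H ^ scale_exp n * bdist (f (p k)) (f (x i))"
      using c(2) xS[OF ij(1)] x(2)[OF ij(1)] by blast
    also have "\<dots> \<le> H ^ scale_exp n * (K * bdist (f (x i)) (f (x j)))"
      using up by (intro mult_left_mono) (auto simp: bdist_sym H_def)
    finally have "c \<le> H ^ scale_exp n * K * bdist (f (x i)) (f (x j))"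
      by (simp add: mult.assoc)
    moreover have Kp: "0 < K" "0 < H"
      by (auto simp: K_def H_def)
    ultimately have low: "c / (H ^ scale_exp n * K) \<le> bdist (f (x i)) (f (x j))"
      by (simp add: field_simps)
    have "scale n ^ n = 1 / (2 ^ n) ^ scale_exp n"
      by (simp add: power_one_over power_mult[symmetric] mult.commute)
    also have "\<dots> \<le> c / (H ^ scale_exp n * K)"
      using big Kp by (simp add: power_divide field_simps)
    finally show ?thesis
      using low by linarith
  qed
  define T where "T = (\<lambda>i. f (x i)) ` {..<branches n}"
  have "inj_on (\<lambda>i. f (x i)) {..<branches n}"
  proof (rule inj_onI, rule ccontr)
    fix i j assume ij: "i \<in> {..<branches n}" "j \<in> {..<branches n}" "f (x i) = f (x j)" "i \<noteq> j"
    then have "0 < bdist (f (x i)) (f (x j))"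
      using sep[of i j] by (auto intro: less_le_trans[of _ "scale n ^ n"])
    then show False
      using ij(3) by (simp add: bdist_pos_iff)
  qed
  then have "card T = branches n"
    by (simp add: T_def card_image)
  moreover have "card T < branches n"
  proof (rule few_separated_points_away_from_owner)
    show "T \<subseteq> S" "finite T"
      using fS xS by (auto simp: T_def)
    show "scale n ^ n \<le> bdist y y'" if "y \<in> T" "y' \<in> T" "y \<noteq> y'" for y y'
      using that sep unfolding T_def by fastforce
    fix y assume "y \<in> T"
    then obtain i where i: "i < branches n" "y = f (x i)"
      by (auto simp: T_def)
    have "dist (x i) (p k) < \<sigma>"
      using dist_le_bdist[of "p k" "x i"] x(2)[OF i(1)] small(2) by (simp add: dist_commute)
    then have "dist y (f (p k)) < \<tau>"
      using \<sigma>(2) xS i by blast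
    moreover have "2 * \<tau> \<le> dist y (f (p k)) + dist y (p k)"
      unfolding \<tau>_def using dist_triangle3[of "f (p k)" "p k" y] by simp
    ultimately show "scale n / lip n \<le> dist y (p (owner n))"
      using step small(1) n(2) by simp
  qed
  ultimately show False
    by simp
qed

text \<open>The fixed points are dense and \<open>f\<close> is continuous, so \<open>f\<close> is
  the identity on \<open>S\<close>.\<close>

lemma co_Hopfian_bmetric: "quasisymmetrically_co_Hopfian bmetric"
  unfolding quasisymmetrically_co_Hopfian_def
proof (intro allI impI)
  fix f assume f: "quasisymmetric_embedding bmetric bmetric f"
  have cont: "continuous_on S f"
    using f by (auto simp: quasisymmetric_embedding_def mtopology_bmetric)
  have "f x = x" if x: "x \<in> S" for x
  proof -
    have "x \<in> closure (range p)"
      using p_dense x by blast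
    then obtain q where q: "\<And>n. q n \<in> range p" "q \<longlonglongrightarrow> x"
      by (auto simp: closure_sequential)
    have "q n \<in> S" for n
      using q(1)[of n] p_in by auto
    then have "(\<lambda>n. f (q n)) \<longlonglongrightarrow> f x"
      using cont x q(2) unfolding continuous_on_sequentially o_def by blast
    moreover have "f (q n) = q n" for n
      using q(1)[of n] quasisymmetric_embedding_fixes_p[OF f] by auto
    ultimately show ?thesis
      using q(2) LIMSEQ_unique by auto
  qed
  then show "f ` mspace bmetric = mspace bmetric"
    by simp
qed

end

text \<open>A countable dense subset of \<open>D\<close> is enumerated as \<open>p\<close>, and
  compactness yields the bounds \<open>M\<close>; what remains for the carpet is to find enough
  continua.\<close>

theorem compatible_co_Hopfian_metric:
  fixes S D :: "'a::{metric_space, second_countable_topology} set"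
  assumes "compact S" "D \<subseteq> S" "S \<subseteq> closure D" "D \<noteq> {}"
    and continua: "\<And>x. x \<in> D \<Longrightarrow> \<exists>E z. connected E \<and> E \<subseteq> S \<and> x \<in> E \<and> z \<in> E \<and> z \<noteq> x"
  obtains X where "mspace X = S" "mtopology_of X = top_of_set S" "quasisymmetrically_co_Hopfian X"
proof -
  obtain C where C: "countable C" "C \<subseteq> D" "D \<subseteq> closure C"
    using separable by metis
  then have "C \<noteq> {}"
    using assms(4) by auto
  define p where "p = from_nat_into C"
  have p: "range p = C"
    unfolding p_def using \<open>C \<noteq> {}\<close> C(1) by (rule range_from_nat_into)
  have pD: "p k \<in> D" for k
    using p C(2) by blast
  have "\<forall>\<delta>. \<exists>M. 0 < \<delta> \<longrightarrow> (\<forall>T\<subseteq>S. finite T \<longrightarrow>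
      (\<forall>x\<in>T. \<forall>y\<in>T. x \<noteq> y \<longrightarrow> \<delta> \<le> dist x y) \<longrightarrow> card T \<le> M)"
    using compact_separated_card_bound[OF assms(1)] by blast
  then obtain M where M: "\<forall>\<delta>. 0 < \<delta> \<longrightarrow> (\<forall>T\<subseteq>S. finite T \<longrightarrow>
      (\<forall>x\<in>T. \<forall>y\<in>T. x \<noteq> y \<longrightarrow> \<delta> \<le> dist x y) \<longrightarrow> card T \<le> M \<delta>)"
    by metis
  interpret branching_metric S p M
  proof
    show "p k \<in> S" for k
      using pD assms(2) by blast
    show "S \<subseteq> closure (range p)"
      using assms(3) C(3) p closure_minimal[of D "closure C"] by auto
    show "\<exists>E z. connected E \<and> E \<subseteq> S \<and> p k \<in> E \<and> z \<in> E \<and> z \<noteq> p k" for k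
      using pD by (rule continua)
    show "card T \<le> M \<delta>" if "0 < \<delta>" "T \<subseteq> S" "finite T"
      "\<And>x y. \<lbrakk>x \<in> T; y \<in> T; x \<noteq> y\<rbrakk> \<Longrightarrow> \<delta> \<le> dist x y" for \<delta> T
      using M that by simp
  qed
  show thesis
    by (rule that[OF mspace_bmetric mtopology_bmetric co_Hopfian_bmetric])
qed

section \<open>Geometry of the standard carpet\<close>

definition carpet_square :: "nat \<Rightarrow> real \<times> real \<Rightarrow> (real \<times> real) set" where
  "carpet_square n c = {fst c..fst c + 1 / 3 ^ n} \<times> {snd c..snd c + 1 / 3 ^ n}"

lemma carpet_square_subset_parent:
  assumes "i < 3" "j < 3"
  shows "carpet_square (Suc n) (x + real i / 3 ^ Suc n, y + real j / 3 ^ Suc n)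
    \<subseteq> carpet_square n (x, y)"
proof -
  have "z + real l / 3 ^ Suc n + 1 / 3 ^ Suc n \<le> z + 1 / 3 ^ n" "z \<le> z + real l / 3 ^ Suc n"
    if "l < 3" for z :: real and l
    using that by (auto simp: field_simps)
  from this[OF assms(1), of x] this[OF assms(2), of y] show ?thesis
    unfolding carpet_square_def fst_conv snd_conv
    by (intro Sigma_mono) (simp_all only: atLeastatMost_subset_iff simp_thms)
qed

text \<open>Reduces questions about overlapping squares to integer inequalities.\<close>

lemma carpet_corners_grid:
  assumes "c \<in> carpet_corners n"
  shows "\<exists>(a::int) (b::int). c = (a / 3 ^ n, b / 3 ^ n)"
  using assms
proof (induction n arbitrary: c)
  case 0
  then show ?case
    by (auto intro!: exI[of _ "0::int"])
next
  case (Suc n)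
  then obtain x y i j where c: "c = (x + real i / 3 ^ Suc n, y + real j / 3 ^ Suc n)"
    and "(x, y) \<in> carpet_corners n"
    by auto
  then obtain a b :: int where "(x, y) = (a / 3 ^ n, b / 3 ^ n)"
    using Suc.IH by blast
  then have "c = (of_int (3 * a + int i) / 3 ^ Suc n, of_int (3 * b + int j) / 3 ^ Suc n)"
    using c by (simp add: field_simps)
  then show ?case
    by blast
qed

text \<open>Squares removed before the last subdivision already miss the parent square. In the last
  one, an overlap would force the excluded child index \<open>(1, 1)\<close>.\<close>

lemma carpet_square_avoids_removed:
  assumes "c \<in> carpet_corners n" "m < n" "d \<in> carpet_corners m"
  shows "carpet_square n c \<inter> open_middle_square m d = {}"
  using assms(1,2)
proof (induction n arbitrary: c)
  case (Suc n)
  then obtain x y i j where c: "c = (x + real i / 3 ^ Suc n, y + real j / 3 ^ Suc n)"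
    and xy: "(x, y) \<in> carpet_corners n" and ij: "i < 3" "j < 3" "(i, j) \<noteq> (1, 1)"
    by auto
  show ?case
  proof (cases "m < n")
    case True
    have "carpet_square (Suc n) c \<subseteq> carpet_square n (x, y)"
      using carpet_square_subset_parent[OF ij(1,2)] by (simp add: c)
    then show ?thesis
      using Suc.IH[OF xy True] by blast
  next
    case False
    then have m: "m = n"
      using Suc.prems by simp
    obtain a b :: int where ab: "x = a / 3 ^ n" "y = b / 3 ^ n"
      using carpet_corners_grid[OF xy] by auto
    obtain a' b' :: int where d: "d = (a' / 3 ^ n, b' / 3 ^ n)"
      using carpet_corners_grid assms(3) m by blast
    \<comment> \<open>One coordinate, scaled by \<open>3 ^ Suc n\<close>: a closed unit interval
      starting at \<open>3 * e + l\<close> meets the open one from \<open>3 * e' + 1\<close> to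
      \<open>3 * e' + 2\<close> only if they start at the same integer, so \<open>l\<close> is 1
      modulo 3.\<close>
    have same: "l = 1"
      if "e / 3 ^ n + real l / 3 ^ Suc n \<le> w" "w \<le> e / 3 ^ n + real l / 3 ^ Suc n + 1 / 3 ^ Suc n"
        "e' / 3 ^ n + 1 / 3 ^ Suc n < w" "w < e' / 3 ^ n + 2 / 3 ^ Suc n" "l < 3"
      for e e' :: int and l w
    proof -
      define v where "v = w * 3 ^ Suc n"
      have "3 * e + real l \<le> v" "v \<le> 3 * e + real l + 1" "3 * e' + 1 < v" "v < 3 * e' + 2"
        using that(1-4) by (auto simp: v_def field_simps)
      then have "3 * e + int l < 3 * e' + 2" "3 * e' + 1 < 3 * e + int l + 1"
        by linarith+
      then show ?thesis
        using that(5) by presburger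
    qed
    show ?thesis
    proof (rule ccontr)
      assume "carpet_square (Suc n) c \<inter> open_middle_square m d \<noteq> {}"
      then obtain u v where "(u, v) \<in> carpet_square (Suc n) c" "(u, v) \<in> open_middle_square n d"
        using m by auto
      then have "i = 1" "j = 1"
        using same[of a i u a'] same[of b j v b'] ij
        by (auto simp: carpet_square_def open_middle_square_def c ab d simp del: power_Suc)
      then show False
        using ij(3) by simp
    qed
  qed
qed simp

lemma mem_standard_carpet_iff:
  "q \<in> standard_carpet \<longleftrightarrow>
     q \<in> {0..1} \<times> {0..1} \<and> (\<forall>m. \<forall>d\<in>carpet_corners m. q \<notin> open_middle_square m d)"
proof -
  have "q \<in> carpet_stage n \<longleftrightarrow>
      q \<in> {0..1} \<times> {0..1} \<and> (\<forall>m<n. \<forall>d\<in>carpet_corners m. q \<notin> open_middle_square m d)" for n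
    by (induction n) (auto simp: less_Suc_eq)
  then show ?thesis
    unfolding standard_carpet_def by blast
qed

lemma compact_standard_carpet: "compact standard_carpet"
proof -
  have eq: "standard_carpet =
      ({0..1} \<times> {0..1}) \<inter> (\<Inter>m. \<Inter>d\<in>carpet_corners m. - open_middle_square m d)"
    by (auto simp: mem_standard_carpet_iff)
  have "closed (- open_middle_square m d)" for m d
    unfolding open_middle_square_def by (intro closed_Compl open_Times) auto
  then show ?thesis
    unfolding eq by (intro compact_Int_closed compact_Times compact_Icc closed_INT ballI)
qed

lemma carpet_square_subset_unit:
  "c \<in> carpet_corners n \<Longrightarrow> carpet_square n c \<subseteq> {0..1} \<times> {0..1}"
proof (induction n arbitrary: c)
  case 0
  then show ?case
    by (simp add: carpet_square_def)
next
  case (Suc n)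
  then obtain x y i j where c: "c = (x + real i / 3 ^ Suc n, y + real j / 3 ^ Suc n)"
    and xy: "(x, y) \<in> carpet_corners n" and ij: "i < 3" "j < 3"
    by auto
  have "carpet_square (Suc n) c \<subseteq> carpet_square n (x, y)"
    using carpet_square_subset_parent[OF ij] by (simp add: c)
  then show ?case
    using Suc.IH[OF xy] by blast
qed

text \<open>Squares removed at stages \<open>m < n\<close> miss the whole carpet square. For
  \<open>m \<ge> n\<close> the abscissa of the edge is a multiple of \<open>1 / 3 ^ m\<close>,
  whereas a removed square lies strictly between two neighbouring multiples.\<close>

lemma left_edge_subset_carpet:
  assumes "c \<in> carpet_corners n"
  shows "{fst c} \<times> {snd c..snd c + 1 / 3 ^ n} \<subseteq> standard_carpet"
proof
  fix q assume q: "q \<in> {fst c} \<times> {snd c..snd c + 1 / 3 ^ n}"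
  then have sq: "q \<in> carpet_square n c"
    by (auto simp: carpet_square_def)
  have "q \<notin> open_middle_square m d" if d: "d \<in> carpet_corners m" for m d
  proof (cases "m < n")
    case True
    then show ?thesis
      using carpet_square_avoids_removed[OF assms True d] sq by blast
  next
    case False
    obtain a b :: int where c: "c = (a / 3 ^ n, b / 3 ^ n)"
      using carpet_corners_grid[OF assms] by blast
    obtain a' b' :: int where d': "d = (a' / 3 ^ m, b' / 3 ^ m)"
      using carpet_corners_grid[OF d] by blast
    have "a / 3 ^ n = of_int (a * 3 ^ (m - n)) / (3::real) ^ m"
      using False by (simp add: power_add[symmetric] field_simps)
    moreover have "fst q = a / 3 ^ n"
      using q c by auto
    ultimately obtain e :: int where e: "fst q = e / 3 ^ m"
      by metis
    show ?thesis
    proof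
      assume "q \<in> open_middle_square m d"
      then have "a' / 3 ^ m + 1 / 3 ^ Suc m < e / 3 ^ m" "e / 3 ^ m < a' / 3 ^ m + 2 / 3 ^ Suc m"
        using e d' by (auto simp: open_middle_square_def)
      then have "(3 * a' + 1) / 3 ^ Suc m < 3 * e / 3 ^ Suc m"
        "3 * e / 3 ^ Suc m < (3 * a' + 2) / 3 ^ Suc m"
        by (simp_all add: add_divide_distrib)
      then have "3 * a' + 1 < 3 * e" "3 * e < 3 * a' + 2"
        by (simp_all only: divide_less_cancel) auto
      then show False
        by linarith
    qed
  qed
  then show "q \<in> standard_carpet"
    using carpet_square_subset_unit[OF assms] sq by (auto simp: mem_standard_carpet_iff)
qed

lemma carpet_squares_cover:
  assumes "q \<in> standard_carpet"
  shows "\<exists>c\<in>carpet_corners n. q \<in> carpet_square n c"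
proof (induction n)
  case 0
  then show ?case
    using assms by (simp add: mem_standard_carpet_iff carpet_square_def)
next
  case (Suc n)
  then obtain x y where xy: "(x, y) \<in> carpet_corners n" "q \<in> carpet_square n (x, y)"
    by auto
  \<comment> \<open>Ties go to the outer thirds. The value 1 thus means strictly inside the middle
    third, and having it in both coordinates would put \<open>q\<close> into a removed
    square.\<close>
  define third where "third = (\<lambda>z w :: real. if w \<le> z + 1 / 3 ^ Suc n then 0::nat
      else if z + 2 / 3 ^ Suc n \<le> w then 2 else 1)"
  have third: "third z w < 3" "z + real (third z w) / 3 ^ Suc n \<le> w"
    "w \<le> z + real (third z w) / 3 ^ Suc n + 1 / 3 ^ Suc n"
    if "z \<le> w" "w \<le> z + 1 / 3 ^ n" for z w
    using that by (auto simp: third_def field_simps)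
  have "(third x (fst q), third y (snd q)) \<noteq> (1, 1)"
  proof
    assume "(third x (fst q), third y (snd q)) = (1, 1)"
    then have "q \<in> open_middle_square n (x, y)"
      by (auto simp: open_middle_square_def third_def mem_Times_iff split: if_splits simp del: power_Suc)
    then show False
      using assms xy(1) by (simp add: mem_standard_carpet_iff)
  qed
  moreover have q: "x \<le> fst q" "fst q \<le> x + 1 / 3 ^ n" "y \<le> snd q" "snd q \<le> y + 1 / 3 ^ n"
    using xy(2) by (auto simp: carpet_square_def)
  ultimately have "(x + real (third x (fst q)) / 3 ^ Suc n, y + real (third y (snd q)) / 3 ^ Suc n)
      \<in> carpet_corners (Suc n)"
    using xy(1) third(1) unfolding carpet_corners.simps by blast
  moreover have "q \<in> carpet_square (Suc n)
      (x + real (third x (fst q)) / 3 ^ Suc n, y + real (third y (snd q)) / 3 ^ Suc n)"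
    using third(2,3)[OF q(1,2)] third(2,3)[OF q(3,4)]
    by (simp add: carpet_square_def mem_Times_iff del: power_Suc)
  ultimately show ?case
    by blast
qed

lemma carpet_corners_dense: "standard_carpet \<subseteq> closure (\<Union>n. carpet_corners n)"
proof
  fix q assume q: "q \<in> standard_carpet"
  show "q \<in> closure (\<Union>n. carpet_corners n)"
    unfolding closure_approachable
  proof (intro allI impI)
    fix e :: real assume "0 < e"
    then obtain n where n: "(1/3)^n < e / 2"
      using real_arch_pow_inv[of "e / 2" "1/3"] by auto
    obtain c where c: "c \<in> carpet_corners n" "q \<in> carpet_square n c"
      using carpet_squares_cover[OF q] by blast
    have "dist c q \<le> dist (fst c) (fst q) + dist (snd c) (snd q)"
      unfolding dist_prod_def by (rule sqrt_sum_squares_le_sum) auto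
    also have "\<dots> \<le> (1/3)^n + (1/3)^n"
      using c(2) by (intro add_mono) (auto simp: carpet_square_def dist_real_def power_one_over)
    finally have "dist c q < e"
      using n by simp
    then show "\<exists>y\<in>\<Union>n. carpet_corners n. dist y q < e"
      using c(1) by blast
  qed
qed

theorem theorem1p2:
  "\<exists>X :: (real \<times> real) metric.
     metric_sierpinski_carpet X \<and> quasisymmetrically_co_Hopfian X"
proof -
  let ?D = "\<Union>n. carpet_corners n"
  have edge: "\<exists>E z. connected E \<and> E \<subseteq> standard_carpet \<and> c \<in> E \<and> z \<in> E \<and> z \<noteq> c"
    if "c \<in> ?D" for c
  proof -
    from that obtain n where n: "c \<in> carpet_corners n"
      by blast
    \<comment> \<open>The left edge serves as the continuum through the corner \<open>c\<close>,
      with its upper end as \<open>z\<close>; it also shows that \<open>c\<close> lies in the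
      carpet.\<close>
    let ?E = "{fst c} \<times> {snd c..snd c + 1 / 3 ^ n}"
    have "connected ?E"
      by (intro connected_Times) auto
    moreover have "c \<in> ?E" "(fst c, snd c + 1 / 3 ^ n) \<in> ?E" "(fst c, snd c + 1 / 3 ^ n) \<noteq> c"
      by (auto simp: mem_Times_iff prod_eq_iff)
    ultimately show ?thesis
      using left_edge_subset_carpet[OF n] by metis
  qed
  have "(0, 0) \<in> carpet_corners 0"
    by simp
  then have "?D \<noteq> {}"
    by blast
  moreover have "?D \<subseteq> standard_carpet"
  proof
    fix c assume "c \<in> ?D"
    then show "c \<in> standard_carpet"
      using edge[of c] by blast
  qed
  ultimately obtain X :: "(real \<times> real) metric" where
    "mtopology_of X = top_of_set standard_carpet" "quasisymmetrically_co_Hopfian X"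
    using compatible_co_Hopfian_metric[OF compact_standard_carpet _ carpet_corners_dense _ edge]
    by blast
  then show ?thesis
    unfolding metric_sierpinski_carpet_def by (metis homeomorphic_space_refl)
qed

end
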